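(* There is a closed, nowhere dense set $A\subseteq[0,1]$ which contains an affine copy of every real sequence $\{\alpha_m\}_{m=1}^\infty$ satisfying at least one of the following: (i) $\alpha_m=O(r^m)$ for some $0<r<1$; (ii) $\alpha_m=O(m^{-s})$ for some $s>0$; (iii) $\alpha_m=O\big((\log^{(k)} m)^{-1}\big)$ as $m\to\infty$ for some integer $k\ge 1$, where $\log^{(k)}$ denotes the $k$-fold iterate of the logarithm (defined and positive for all sufficiently large $m$).
   Context: A set $A\subseteq\mathbb R$ contains an affine copy of the sequence $\{\alpha_m\}$ if there exist $\delta\ne 0$ and $t\in\mathbb R$ such that $t+\delta\alpha_m\in A$ for all $m$. A set is nowhere dense if the interior of its closure is empty. *)

theory Defs
  imports "HOL-Analysis.Analysis" "HOL-Library.Landau_Symbols"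
begin

definition nowhere_dense :: "'a::topological_space set \<Rightarrow> bool" where
  "nowhere_dense A \<longleftrightarrow> interior (closure A) = {}"

(* Sequences are indexed by m = 1, 2, ...; the value at index 0 plays no role. *)
definition contains_affine_copy :: "real set \<Rightarrow> (nat \<Rightarrow> real) \<Rightarrow> bool" where
  "contains_affine_copy A \<alpha> \<longleftrightarrow>
     (\<exists>\<delta> t. \<delta> \<noteq> 0 \<and> (\<forall>m\<ge>1. t + \<delta> * \<alpha> m \<in> A))"

(* For small m an iterate may be undefined in the usual sense (ln of a nonpositive number);
   iter_log is meant to be used only for all sufficiently large arguments. *)
definition iter_log :: "nat \<Rightarrow> real \<Rightarrow> real" where
  "iter_log k x = (ln ^^ k) x"

end

theory Submission
  imports Defs "HOL-Real_Asymp.Real_Asymp"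
begin

text \<open>
  The set \<open>A\<close> is \<open>[0, 1]\<close> with a tiny ball \<open>ball (q j) (\<epsilon> j)\<close> removed around the \<open>j\<close>-th rational,
  for every \<open>j\<close>; it is closed and nowhere dense for all radii \<open>\<epsilon> j > 0\<close>. A translate \<open>t\<close> is bad for
  a sequence \<open>\<alpha>\<close> if some \<open>t + \<alpha> m\<close> falls into a removed ball. Suppose that \<open>\<bar>\<alpha> m\<bar> \<le> \<eta> j\<close> for all
  \<open>m \<ge> N j\<close>. Then the translates that are bad because of the \<open>j\<close>-th ball lie in \<open>N j\<close> balls of
  radius \<open>\<epsilon> j\<close>, one for each of the early terms, and in one ball of radius \<open>\<epsilon> j + \<eta> j\<close>, which
  accounts for all the late terms at once. For \<open>\<epsilon> j = \<eta> j / (N j + 1)\<close> the lengths of these balls add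
  up to \<open>4 \<cdot> \<eta> j\<close>, and if the sum of all \<open>\<eta> j\<close> is small, a good \<open>t\<close> remains
  (\<open>exists_good_translate\<close>).

  So one set \<open>A\<close>, depending only on \<open>N\<close>, serves all sequences that decay at the rate prescribed
  by \<open>N\<close>. Given countably many null sequences \<open>f k\<close>, a diagonal choice of \<open>N\<close> makes this rate
  slower than every multiple of each \<open>f k\<close>, up to finitely many \<open>j\<close>; those are dealt with by the
  dilation \<open>\<delta>\<close> (\<open>exists_set_for_countably_many_rates\<close>). The theorem is the case where \<open>f k\<close> is the
  reciprocal of the iterated logarithm, since geometric and polynomial decay are both faster than
  the decay of \<open>1 / ln m\<close>.
\<close>

section \<open>Removing small balls around the rationals\<close>

definition rational_seq :: "nat \<Rightarrow> real" where
  "rational_seq = from_nat_into \<rat>"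

definition punctured_interval :: "(nat \<Rightarrow> real) \<Rightarrow> real set" where
  "punctured_interval \<epsilon> = {0..1} - (\<Union>j. ball (rational_seq j) (\<epsilon> j))"

lemma range_rational_seq: "range rational_seq = \<rat>"
  unfolding rational_seq_def using countable_rat Rats_0 by (intro range_from_nat_into) auto

lemma closed_punctured_interval: "closed (punctured_interval \<epsilon>)"
  unfolding punctured_interval_def by (intro closed_Diff open_UN ballI) auto

lemma nowhere_dense_punctured_interval:
  assumes "\<And>j. \<epsilon> j > 0"
  shows "nowhere_dense (punctured_interval \<epsilon>)"
proof -
  have "interior (punctured_interval \<epsilon>) = {}"
  proof (rule ccontr)
    assume "interior (punctured_interval \<epsilon>) \<noteq> {}"
    then obtain x e where "e > 0" and sub: "ball x e \<subseteq> punctured_interval \<epsilon>"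
      by (auto simp: mem_interior)
    obtain q where "q \<in> \<rat>" "x < q" "q < x + e"
      using Rats_dense_in_real[of x "x + e"] \<open>e > 0\<close> by auto
    moreover obtain j where "q = rational_seq j"
      using \<open>q \<in> \<rat>\<close> range_rational_seq by auto
    ultimately have "rational_seq j \<in> punctured_interval \<epsilon>"
      using sub by (auto simp: dist_real_def)
    then show False
      using assms[of j] centre_in_ball[of "rational_seq j" "\<epsilon> j"]
      unfolding punctured_interval_def by blast
  qed
  then show ?thesis
    by (simp add: nowhere_dense_def closed_punctured_interval closure_closed)
qed

section \<open>Translates that avoid the removed balls\<close>

text \<open>
  The bounds \<open>2\<^sup>-\<^sup>j / 32\<close> are chosen so that the bad translates have total length at most
  \<open>4 \<cdot> (2 / 32) = 1/4\<close>, less than the length of \<open>[1/4, 3/4]\<close>, where \<open>t\<close> is sought so that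
  \<open>t + \<alpha> m\<close> stays in \<open>[0, 1]\<close>.
\<close>

definition tail_bound :: "nat \<Rightarrow> real" where
  "tail_bound j = (1/2) ^ j / 32"

lemma tail_bound_pos: "tail_bound j > 0"
  by (simp add: tail_bound_def)

lemma tail_bound_antimono: "i \<le> j \<Longrightarrow> tail_bound j \<le> tail_bound i"
  by (simp add: tail_bound_def power_decreasing)

lemma tail_bound_le: "tail_bound j \<le> 1/4"
  using tail_bound_antimono[of 0 j] by (simp add: tail_bound_def)

lemma tail_bound_sums: "(\<lambda>j. 4 * tail_bound j) sums (1/4)"
proof -
  have "(\<lambda>j. (1/8) * (1/2) ^ j :: real) sums ((1/8) * (1 / (1 - 1/2)))"
    by (intro sums_mult geometric_sums) auto
  then show ?thesis
    by (simp add: tail_bound_def)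
qed

definition hole_radius :: "(nat \<Rightarrow> nat) \<Rightarrow> nat \<Rightarrow> real" where
  "hole_radius N j = tail_bound j / (N j + 1)"

lemma hole_radius_pos: "hole_radius N j > 0"
  by (simp add: hole_radius_def tail_bound_pos)

text \<open>
  A set that contains all translates in \<open>[1/4, 3/4]\<close> that are bad because of the \<open>j\<close>-th removed ball,
  provided that \<open>\<alpha>\<close> obeys the bounds belonging to \<open>N\<close>: the last ball catches all terms of index at
  least \<open>N j\<close> together, because they differ from \<open>0\<close> by at most \<open>tail_bound j\<close>.
\<close>

definition bad_translates :: "(nat \<Rightarrow> nat) \<Rightarrow> (nat \<Rightarrow> real) \<Rightarrow> nat \<Rightarrow> real set" where
  "bad_translates N \<alpha> j =
     (\<Union>m\<in>{..<N j}. ball (rational_seq j - \<alpha> m) (hole_radius N j)) \<union>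
     ball (rational_seq j) (hole_radius N j + tail_bound j)"

lemma emeasure_lborel_ball_real:
  fixes x r :: real
  assumes "r \<ge> 0"
  shows "emeasure lborel (ball x r) = ennreal (2 * r)"
  using assms by (simp add: ball_eq_greaterThanLessThan)

lemma emeasure_bad_translates:
  "emeasure lborel (bad_translates N \<alpha> j) \<le> ennreal (4 * tail_bound j)"
proof -
  let ?\<epsilon> = "hole_radius N j" and ?\<eta> = "tail_bound j"
  have pos: "?\<epsilon> \<ge> 0" "?\<eta> \<ge> 0"
    using hole_radius_pos[of N j] tail_bound_pos[of j] by auto
  have "emeasure lborel (\<Union>m\<in>{..<N j}. ball (rational_seq j - \<alpha> m) ?\<epsilon>)
          \<le> (\<Sum>m<N j. emeasure lborel (ball (rational_seq j - \<alpha> m) ?\<epsilon>))"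
    by (rule emeasure_subadditive_finite) auto
  also have "\<dots> = ennreal (N j * (2 * ?\<epsilon>))"
    using pos by (simp add: emeasure_lborel_ball_real ennreal_of_nat_eq_real_of_nat ennreal_mult)
  finally have early: "emeasure lborel (\<Union>m\<in>{..<N j}. ball (rational_seq j - \<alpha> m) ?\<epsilon>)
          \<le> ennreal (N j * (2 * ?\<epsilon>))" .
  have "emeasure lborel (bad_translates N \<alpha> j)
      \<le> emeasure lborel (\<Union>m\<in>{..<N j}. ball (rational_seq j - \<alpha> m) ?\<epsilon>)
        + emeasure lborel (ball (rational_seq j) (?\<epsilon> + ?\<eta>))"
    unfolding bad_translates_def by (rule emeasure_subadditive) auto
  also have "\<dots> \<le> ennreal (N j * (2 * ?\<epsilon>)) + ennreal (2 * (?\<epsilon> + ?\<eta>))"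
    using pos by (intro add_mono early) (simp add: emeasure_lborel_ball_real)
  also have "\<dots> = ennreal (N j * (2 * ?\<epsilon>) + 2 * (?\<epsilon> + ?\<eta>))"
    using pos by (simp add: ennreal_plus)
  also have "N j * (2 * ?\<epsilon>) + 2 * (?\<epsilon> + ?\<eta>) = 2 * ((N j + 1) * ?\<epsilon>) + 2 * ?\<eta>"
    by (simp add: algebra_simps)
  also have "(N j + 1) * ?\<epsilon> = ?\<eta>"
    by (simp add: hole_radius_def)
  also have "2 * ?\<eta> + 2 * ?\<eta> = 4 * ?\<eta>"
    by simp
  finally show ?thesis .
qed

text \<open>
  The bad translates have total length at most \<open>1/4\<close>, so they do not cover \<open>[1/4, 3/4]\<close>.
\<close>

lemma exists_good_translate:
  assumes small: "\<And>m. \<bar>\<alpha> m\<bar> \<le> 1/4"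
    and decay: "\<And>j m. m \<ge> N j \<Longrightarrow> \<bar>\<alpha> m\<bar> \<le> tail_bound j"
  shows "\<exists>t. \<forall>m. t + \<alpha> m \<in> punctured_interval (hole_radius N)"
proof (rule ccontr)
  assume no: "\<not> ?thesis"
  have cover: "{1/4..3/4} \<subseteq> (\<Union>j. bad_translates N \<alpha> j)"
  proof
    fix t :: real
    assume t: "t \<in> {1/4..3/4}"
    from no obtain m where m: "t + \<alpha> m \<notin> punctured_interval (hole_radius N)"
      by blast
    have "t + \<alpha> m \<in> {0..1}"
      using t small[of m] by (auto simp: abs_le_iff)
    with m obtain j where j: "\<bar>rational_seq j - (t + \<alpha> m)\<bar> < hole_radius N j"
      by (auto simp: punctured_interval_def dist_real_def)
    have "t \<in> bad_translates N \<alpha> j"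
    proof (cases "m < N j")
      case True
      with j have "t \<in> ball (rational_seq j - \<alpha> m) (hole_radius N j)"
        by (simp add: dist_real_def algebra_simps)
      with True show ?thesis
        by (auto simp: bad_translates_def)
    next
      case False
      with decay[of j m] j have "\<bar>rational_seq j - t\<bar> < hole_radius N j + tail_bound j"
        by linarith
      then show ?thesis
        by (simp add: bad_translates_def dist_real_def)
    qed
    then show "t \<in> (\<Union>j. bad_translates N \<alpha> j)"
      by blast
  qed
  have meas: "bad_translates N \<alpha> j \<in> sets lborel" for j
    by (auto simp: bad_translates_def)
  have "ennreal (1/2) = emeasure lborel {1/4..3/4::real}"
    by simp
  also have "\<dots> \<le> emeasure lborel (\<Union>j. bad_translates N \<alpha> j)"
    using meas by (intro emeasure_mono cover sets.countable_UN) auto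
  also have "\<dots> \<le> (\<Sum>j. emeasure lborel (bad_translates N \<alpha> j))"
    using meas by (intro emeasure_subadditive_countably) auto
  also have "\<dots> \<le> (\<Sum>j. ennreal (4 * tail_bound j))"
    by (intro suminf_le emeasure_bad_translates) auto
  also have "\<dots> = ennreal (1/4)"
    using tail_bound_sums tail_bound_pos
    by (intro suminf_ennreal_eq) (auto intro: less_imp_le)
  finally have "ennreal (1/2) \<le> ennreal (1/4)" .
  then show False
    by (subst (asm) ennreal_le_iff) auto
qed

section \<open>Countably many rates of decay\<close>

text \<open>
  A rate slower than all the given ones, by diagonalisation: \<open>N j\<close> takes care of only the first
  \<open>j + 1\<close> of the sequences. The condition \<open>N j \<ge> j\<close> ensures that an estimate valid for all large \<open>m\<close>
  holds for all \<open>m \<ge> N j\<close> once \<open>j\<close> is large.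
\<close>

lemma exists_common_threshold:
  fixes f :: "nat \<Rightarrow> nat \<Rightarrow> real"
  assumes null: "\<And>k. f k \<longlonglongrightarrow> 0" and pos: "\<And>j. h j > 0"
  obtains N :: "nat \<Rightarrow> nat"
  where "\<And>j. N j \<ge> j" and "\<And>j k m. k \<le> j \<Longrightarrow> m \<ge> N j \<Longrightarrow> \<bar>f k m\<bar> \<le> h j"
proof -
  have "\<exists>n\<ge>j. \<forall>m\<ge>n. \<forall>k\<in>{..j}. \<bar>f k m\<bar> \<le> h j" for j
  proof -
    have "\<forall>\<^sub>F m in sequentially. \<bar>f k m\<bar> < h j" for k
      using tendstoD[OF null pos, of k j] by simp
    then have "\<forall>\<^sub>F m in sequentially. \<forall>k\<in>{..j}. \<bar>f k m\<bar> < h j"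
      by (intro eventually_ball_finite) auto
    then obtain n where "\<forall>m\<ge>n. \<forall>k\<in>{..j}. \<bar>f k m\<bar> < h j"
      by (auto simp: eventually_sequentially)
    then show ?thesis
      by (intro exI[of _ "max n j"]) (auto intro: less_imp_le)
  qed
  then obtain N where "\<And>j. N j \<ge> j \<and> (\<forall>m\<ge>N j. \<forall>k\<in>{..j}. \<bar>f k m\<bar> \<le> h j)"
    by metis
  then show thesis
    by (intro that[of N]) auto
qed

text \<open>
  With the threshold \<open>N j\<close> for \<open>tail_bound j / (j + 1)\<close>, the factor \<open>j + 1\<close> absorbs any implied
  constant once \<open>j\<close> is large. For the remaining finitely many \<open>j\<close> it suffices to shrink the
  sequence below the smallest of the bounds that occur.
\<close>

lemma exists_set_for_countably_many_rates:
  fixes f :: "nat \<Rightarrow> nat \<Rightarrow> real"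
  assumes null: "\<And>k. f k \<longlonglongrightarrow> 0"
  shows "\<exists>A :: real set. closed A \<and> nowhere_dense A \<and> A \<subseteq> {0..1} \<and>
           (\<forall>\<alpha> k. \<alpha> \<in> O(f k) \<longrightarrow> contains_affine_copy A \<alpha>)"
proof -
  obtain N where N_ge: "\<And>j. N j \<ge> j"
    and N: "\<And>j k m. k \<le> j \<Longrightarrow> m \<ge> N j \<Longrightarrow> \<bar>f k m\<bar> \<le> tail_bound j / (j + 1)"
  proof (rule exists_common_threshold[of f "\<lambda>j. tail_bound j / (j + 1)"])
    show "tail_bound j / (j + 1) > 0" for j
      using tail_bound_pos[of j] by simp
  qed (use null in blast)+
  let ?A = "punctured_interval (hole_radius N)"
  have copy: "contains_affine_copy ?A \<alpha>" if \<alpha>: "\<alpha> \<in> O(f k)" for \<alpha> k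
  proof -
    obtain c where "c > 0" and "\<forall>\<^sub>F m in sequentially. \<bar>\<alpha> m\<bar> \<le> c * \<bar>f k m\<bar>"
      using landau_o.bigE[OF \<alpha>] unfolding real_norm_def by blast
    then obtain M where cM: "\<And>m. m \<ge> M \<Longrightarrow> \<bar>\<alpha> m\<bar> \<le> c * \<bar>f k m\<bar>"
      unfolding eventually_sequentially by blast
    have "\<alpha> \<longlonglongrightarrow> 0"
      using smalloD_tendsto[OF landau_o.big_small_trans[OF \<alpha> smalloI_tendsto[of _ "\<lambda>_. 1"]]]
        null[of k] by simp
    then have "Bseq \<alpha>"
      by (intro convergent_imp_Bseq) (auto simp: convergent_def)
    then obtain B where B: "B > 0" "\<And>m. \<bar>\<alpha> m\<bar> \<le> B"
      by (auto simp: Bseq_def)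
    obtain J :: nat where J: "J \<ge> k" "J \<ge> M" "real J \<ge> c"
    proof -
      obtain n :: nat where "real n \<ge> c"
        using real_arch_simple by blast
      then show thesis
        by (intro that[of "max k (max M n)"]) auto
    qed
    have large: "\<bar>\<alpha> m\<bar> \<le> tail_bound j" if "j \<ge> J" "m \<ge> N j" for j m
    proof -
      have "\<bar>\<alpha> m\<bar> \<le> c * \<bar>f k m\<bar>"
        using cM[of m] that J N_ge[of j] by linarith
      also have "\<dots> \<le> (j + 1) * (tail_bound j / (j + 1))"
        using N[of k j m] that J \<open>c > 0\<close> by (intro mult_mono) auto
      finally show ?thesis
        by simp
    qed
    define \<delta> where "\<delta> = min 1 (tail_bound J / B)"
    have \<delta>: "\<delta> > 0" "\<delta> \<le> 1"
      using B tail_bound_pos[of J] by (auto simp: \<delta>_def)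
    have shrunk: "\<bar>\<delta> * \<alpha> m\<bar> \<le> tail_bound J" for m
    proof -
      have "\<bar>\<delta> * \<alpha> m\<bar> \<le> (tail_bound J / B) * B"
        unfolding abs_mult using B \<delta> tail_bound_pos[of J]
        by (intro mult_mono) (auto simp: \<delta>_def)
      with B show ?thesis
        by simp
    qed
    have "\<exists>t. \<forall>m. t + \<delta> * \<alpha> m \<in> ?A"
    proof (rule exists_good_translate)
      show "\<bar>\<delta> * \<alpha> m\<bar> \<le> 1/4" for m
        using shrunk[of m] tail_bound_le[of J] by linarith
      show "\<bar>\<delta> * \<alpha> m\<bar> \<le> tail_bound j" if "m \<ge> N j" for j m
      proof (cases "j \<le> J")
        case True
        with shrunk[of m] tail_bound_antimono[of j J] show ?thesis
          by linarith
      next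
        case False
        have "\<bar>\<delta> * \<alpha> m\<bar> \<le> 1 * \<bar>\<alpha> m\<bar>"
          unfolding abs_mult using \<delta> by (intro mult_right_mono) auto
        with large[of j m] False that show ?thesis
          by linarith
      qed
    qed
    then obtain t where "\<forall>m. t + \<delta> * \<alpha> m \<in> ?A" ..
    with \<delta>(1) show ?thesis
      unfolding contains_affine_copy_def by (intro exI[of _ \<delta>] exI[of _ t]) simp
  qed
  have "?A \<subseteq> {0..1}"
    unfolding punctured_interval_def by blast
  moreover have "nowhere_dense ?A"
    by (intro nowhere_dense_punctured_interval hole_radius_pos)
  ultimately show ?thesis
    using closed_punctured_interval copy by (intro exI[of _ ?A] conjI allI impI)
qed

section \<open>Iterated logarithms\<close>

lemma filterlim_iter_log_at_top: "filterlim (iter_log k) at_top at_top"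
proof (induction k)
  case 0
  then show ?case
    by (simp add: iter_log_def[abs_def] filterlim_ident)
next
  case (Suc k)
  have "filterlim (\<lambda>x. ln (iter_log k x)) at_top at_top"
    by (rule filterlim_compose[OF ln_at_top Suc])
  then show ?case
    by (simp add: iter_log_def[abs_def])
qed

lemma inverse_iter_log_tendsto_0: "(\<lambda>m. inverse (iter_log k (real m))) \<longlonglongrightarrow> 0"
  by (intro tendsto_inverse_0_at_top filterlim_compose[OF filterlim_iter_log_at_top]
      filterlim_real_sequentially)

lemma geometric_bigo_inverse_ln:
  fixes r :: real
  assumes "0 < r" "r < 1"
  shows "(\<lambda>m. r ^ m) \<in> O(\<lambda>m::nat. inverse (ln (real m)))"
  using assms by real_asymp

lemma powr_bigo_inverse_ln:
  fixes s :: real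
  assumes "s > 0"
  shows "(\<lambda>m. real m powr (- s)) \<in> O(\<lambda>m::nat. inverse (ln (real m)))"
  using assms by real_asymp

theorem corollary1p3:
  shows "\<exists>A :: real set. closed A \<and> nowhere_dense A \<and> A \<subseteq> {0..1} \<and>
    (\<forall>\<alpha> :: nat \<Rightarrow> real.
       (\<exists>r::real. 0 < r \<and> r < 1 \<and> \<alpha> \<in> O[sequentially](\<lambda>m. r ^ m)) \<or>
       (\<exists>s::real. s > 0 \<and> \<alpha> \<in> O[sequentially](\<lambda>m. real m powr (- s))) \<or>
       (\<exists>k::nat. k \<ge> 1 \<and> \<alpha> \<in> O[sequentially](\<lambda>m. inverse (iter_log k (real m))))
       \<longrightarrow> contains_affine_copy A \<alpha>)"
proof -
  define f :: "nat \<Rightarrow> nat \<Rightarrow> real" where "f k m = inverse (iter_log k (real m))" for k m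
  have f1: "f 1 = (\<lambda>m. inverse (ln (real m)))"
    by (simp add: f_def[abs_def] iter_log_def)
  have null: "f k \<longlonglongrightarrow> 0" for k
    using inverse_iter_log_tendsto_0[of k] by (simp add: f_def[abs_def])
  obtain A :: "real set" where A: "closed A" "nowhere_dense A" "A \<subseteq> {0..1}"
    and copy: "\<And>\<alpha> k. \<alpha> \<in> O(f k) \<Longrightarrow> contains_affine_copy A \<alpha>"
    using exists_set_for_countably_many_rates[of f, OF null] by blast
  have geometric: "contains_affine_copy A \<alpha>"
    if "0 < r" "r < 1" "\<alpha> \<in> O(\<lambda>m. r ^ m)" for \<alpha> and r :: real
    using landau_o.big_trans[OF that(3) geometric_bigo_inverse_ln[OF that(1,2)]]
    by (rule copy[of \<alpha> 1, unfolded f1])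
  have polynomial: "contains_affine_copy A \<alpha>"
    if "s > 0" "\<alpha> \<in> O(\<lambda>m. real m powr (- s))" for \<alpha> s
    using landau_o.big_trans[OF that(2) powr_bigo_inverse_ln[OF that(1)]]
    by (rule copy[of \<alpha> 1, unfolded f1])
  have logarithmic: "contains_affine_copy A \<alpha>"
    if "\<alpha> \<in> O(\<lambda>m. inverse (iter_log k (real m)))" for \<alpha> k
    using that by (rule copy[of \<alpha> k, unfolded f_def[abs_def]])
  show ?thesis
  proof (intro exI[of _ A] conjI A allI impI, elim disjE exE conjE)
  qed (rule geometric polynomial logarithmic; assumption)+
qed

end
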